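(* Let $\mathcal{M}$ be a finite model with domain $\{a_1,\dots,a_n\}$ and relations $R_1,\dots,R_m$, and consider Finite Domain Logic of $\mathcal{M}$ as described in the context. For every closed proposition $B$, the following are equivalent: (1) the sequent $\vdash B$ (with empty context) has a proof in Finite Domain Logic of $\mathcal{M}$; (2) $B$ is valid in $\mathcal{M}$; (3) the sequent $\vdash B$ has a proof in Finite Domain Logic of $\mathcal{M}$ that uses introduction rules only.
   Context: The language has constants $c_1,\dots,c_n$ (interpreted by $a_1,\dots,a_n$) and predicate symbols $P_1,\dots,P_m$ (interpreted by $R_1,\dots,R_m$), and no function symbols. Propositions are built from literals (atomic propositions $P_i(t_1,\dots,t_k)$ and their negations $\neg P_i(t_1,\dots,t_k)$), $\top$, $\bot$, $\wedge$, $\vee$, $\forall$, $\exists$ (negation occurs only on atoms; $A\Rightarrow B$ abbreviates $\neg A\vee B$ with negation pushed to atoms by de Morgan's laws). Let $\mathcal{P}$ be the set containing, for each closed atomic proposition $P_i(c_{j_1},\dots,c_{j_k})$, the proposition $P_i(c_{j_1},\dots,c_{j_k})$ if $\langle a_{j_1},\dots,a_{j_k}\rangle\in R_i$, and $\neg P_i(c_{j_1},\dots,c_{j_k})$ otherwise. Sequents are $\Gamma\vdash A$ with $\Gamma$ a finite list of propositions. The rules of Finite Domain Logic of $\mathcal{M}$ are. Introduction rules: axiom: $\Gamma, A\vdash A$; atom: $\Gamma\vdash L$ for $L\in\mathcal{P}$; $\top$-intro: $\Gamma\vdash\top$; $\wedge$-intro: from $\Gamma\vdash A$ and $\Gamma\vdash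 B$ infer $\Gamma\vdash A\wedge B$; $\vee$-intro: from $\Gamma\vdash A$ infer $\Gamma\vdash A\vee B$, and from $\Gamma\vdash B$ infer $\Gamma\vdash A\vee B$; $\forall$-intro: from $\Gamma\vdash (c_1/x)A,\dots,\Gamma\vdash(c_n/x)A$ infer $\Gamma\vdash\forall x\,A$; $\exists$-intro: from $\Gamma\vdash (c_i/x)A$ infer $\Gamma\vdash\exists x\,A$ (any $i$). Non-introduction rules: $\bot$-elim: from $\Gamma\vdash\bot$ infer $\Gamma\vdash A$; $\wedge$-elim: from $\Gamma\vdash A\wedge B$ infer $\Gamma\vdash A$, and infer $\Gamma\vdash B$; $\vee$-elim: from $\Gamma\vdash A\vee B$, $\Gamma,A\vdash C$, $\Gamma,B\vdash C$ infer $\Gamma\vdash C$; $\forall$-elim: from $\Gamma\vdash\forall x\,A$ infer $\Gamma\vdash (c_i/x)A$ (any $i$); $\exists$-elim: from $\Gamma\vdash\exists x\,A$, $\Gamma,(c_1/x)A\vdash C,\dots,\Gamma,(c_n/x)A\vdash C$ infer $\Gamma\vdash C$. Validity in $\mathcal{M}$ is the usual truth of the closed proposition in $\mathcal{M}$ with $c_i$ interpreted as $a_i$. *)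

theory Defs
  imports Main
begin

datatype fterm = Var nat | Const nat

datatype formula =
    Atom nat "fterm list"
  | NegAtom nat "fterm list"
  | Top
  | Bot
  | And formula formula
  | Or formula formula
  | Forall nat formula
  | Exists nat formula

primrec term_subst :: "nat \<Rightarrow> nat \<Rightarrow> fterm \<Rightarrow> fterm" where
  "term_subst j x (Var y) = (if y = x then Const j else Var y)"
| "term_subst j x (Const k) = Const k"

text \<open>\<open>subst j x A\<close> is \<open>(c\<^sub>j/x)A\<close>. Only constants are substituted, so no variable can be captured.\<close>

primrec subst :: "nat \<Rightarrow> nat \<Rightarrow> formula \<Rightarrow> formula" where
  "subst j x (Atom i ts) = Atom i (map (term_subst j x) ts)"
| "subst j x (NegAtom i ts) = NegAtom i (map (term_subst j x) ts)"
| "subst j x Top = Top"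
| "subst j x Bot = Bot"
| "subst j x (And A B) = And (subst j x A) (subst j x B)"
| "subst j x (Or A B) = Or (subst j x A) (subst j x B)"
| "subst j x (Forall y A) = Forall y (if y = x then A else subst j x A)"
| "subst j x (Exists y A) = Exists y (if y = x then A else subst j x A)"

primrec term_vars :: "fterm \<Rightarrow> nat set" where
  "term_vars (Var x) = {x}"
| "term_vars (Const j) = {}"

primrec free_vars :: "formula \<Rightarrow> nat set" where
  "free_vars (Atom i ts) = (\<Union>t\<in>set ts. term_vars t)"
| "free_vars (NegAtom i ts) = (\<Union>t\<in>set ts. term_vars t)"
| "free_vars Top = {}"
| "free_vars Bot = {}"
| "free_vars (And A B) = free_vars A \<union> free_vars B"
| "free_vars (Or A B) = free_vars A \<union> free_vars B"
| "free_vars (Forall x A) = free_vars A - {x}"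
| "free_vars (Exists x A) = free_vars A - {x}"

definition closed_prop :: "formula \<Rightarrow> bool" where
  "closed_prop A \<longleftrightarrow> free_vars A = {}"

text \<open>
  The elements \<open>a\<^sub>1, \<dots>, a\<^sub>n\<close> are \<open>elt M 1, \<dots>, elt M (size_dom M)\<close>, and the relations
  \<open>R\<^sub>1, \<dots>, R\<^sub>m\<close> are \<open>rel M 1, \<dots>, rel M (num_rels M)\<close>, tuples being lists. Values of the
  fields at indices outside these ranges are irrelevant.
\<close>

record 'a model =
  size_dom :: nat
  elt :: "nat \<Rightarrow> 'a"
  num_rels :: nat
  arity :: "nat \<Rightarrow> nat"
  rel :: "nat \<Rightarrow> 'a list set"

definition const_indices :: "'a model \<Rightarrow> nat set" where
  "const_indices M = {1..size_dom M}"

definition pred_indices :: "'a model \<Rightarrow> nat set" where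
  "pred_indices M = {1..num_rels M}"

definition dom_of :: "'a model \<Rightarrow> 'a set" where
  "dom_of M = elt M ` const_indices M"

definition finite_model :: "'a model \<Rightarrow> bool" where
  "finite_model M \<longleftrightarrow>
    (\<forall>i\<in>pred_indices M. \<forall>as\<in>rel M i. length as = arity M i \<and> set as \<subseteq> dom_of M)"

text \<open>Membership in the language of \<open>M\<close>, which has constants \<open>c\<^sub>1, \<dots>, c\<^sub>n\<close> and predicate
  symbols \<open>P\<^sub>1, \<dots>, P\<^sub>m\<close> of the given arities.\<close>

primrec wf_term :: "'a model \<Rightarrow> fterm \<Rightarrow> bool" where
  "wf_term M (Var x) \<longleftrightarrow> True"
| "wf_term M (Const j) \<longleftrightarrow> j \<in> const_indices M"

definition wf_atom :: "'a model \<Rightarrow> nat \<Rightarrow> fterm list \<Rightarrow> bool" where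
  "wf_atom M i ts \<longleftrightarrow>
    i \<in> pred_indices M \<and> length ts = arity M i \<and> (\<forall>t\<in>set ts. wf_term M t)"

primrec wf_prop :: "'a model \<Rightarrow> formula \<Rightarrow> bool" where
  "wf_prop M (Atom i ts) \<longleftrightarrow> wf_atom M i ts"
| "wf_prop M (NegAtom i ts) \<longleftrightarrow> wf_atom M i ts"
| "wf_prop M Top \<longleftrightarrow> True"
| "wf_prop M Bot \<longleftrightarrow> True"
| "wf_prop M (And A B) \<longleftrightarrow> wf_prop M A \<and> wf_prop M B"
| "wf_prop M (Or A B) \<longleftrightarrow> wf_prop M A \<and> wf_prop M B"
| "wf_prop M (Forall x A) \<longleftrightarrow> wf_prop M A"
| "wf_prop M (Exists x A) \<longleftrightarrow> wf_prop M A"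

primrec term_val :: "'a model \<Rightarrow> (nat \<Rightarrow> 'a) \<Rightarrow> fterm \<Rightarrow> 'a" where
  "term_val M e (Var x) = e x"
| "term_val M e (Const j) = elt M j"

primrec holds :: "'a model \<Rightarrow> (nat \<Rightarrow> 'a) \<Rightarrow> formula \<Rightarrow> bool" where
  "holds M e (Atom i ts) \<longleftrightarrow> map (term_val M e) ts \<in> rel M i"
| "holds M e (NegAtom i ts) \<longleftrightarrow> map (term_val M e) ts \<notin> rel M i"
| "holds M e Top \<longleftrightarrow> True"
| "holds M e Bot \<longleftrightarrow> False"
| "holds M e (And A B) \<longleftrightarrow> holds M e A \<and> holds M e B"
| "holds M e (Or A B) \<longleftrightarrow> holds M e A \<or> holds M e B"
| "holds M e (Forall x A) \<longleftrightarrow> (\<forall>a\<in>dom_of M. holds M (e(x := a)) A)"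
| "holds M e (Exists x A) \<longleftrightarrow> (\<exists>a\<in>dom_of M. holds M (e(x := a)) A)"

text \<open>Used for closed propositions only, whose truth value does not depend on \<open>e\<close>. The assignments
  are not restricted to \<open>dom_of M\<close>, so that this remains truth in \<open>M\<close> when \<open>dom_of M\<close> is empty.\<close>

definition valid_in :: "'a model \<Rightarrow> formula \<Rightarrow> bool" where
  "valid_in M A \<longleftrightarrow> (\<forall>e. holds M e A)"

text \<open>The set \<open>\<P>\<close> of closed literals determined by the model.\<close>

definition literals :: "'a model \<Rightarrow> formula set" where
  "literals M =
    {if map (elt M) js \<in> rel M i then Atom i (map Const js) else NegAtom i (map Const js) | i js.
      i \<in> pred_indices M \<and> length js = arity M i \<and> set js \<subseteq> const_indices M}"

datatype sequent = Sequent "formula list" formula (infix "\<turnstile>" 50)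

primrec wf_sequent :: "'a model \<Rightarrow> sequent \<Rightarrow> bool" where
  "wf_sequent M (\<Gamma> \<turnstile> A) \<longleftrightarrow> (\<forall>B\<in>set \<Gamma>. wf_prop M B) \<and> wf_prop M A"

datatype rule =
    Axiom | AtomRule | TopI | AndI | OrI | ForallI | ExistsI
  | BotE | AndE | OrE | ForallE | ExistsE

definition intro_rules :: "rule set" where
  "intro_rules = {Axiom, AtomRule, TopI, AndI, OrI, ForallI, ExistsI}"

text \<open>
  \<open>inference M r ps s\<close>: the sequent \<open>s\<close> follows from the list \<open>ps\<close> of premises by one application
  of the rule \<open>r\<close>. The context \<open>\<Gamma>, A\<close> is the list \<open>A # \<Gamma>\<close>. There being no structural rules, the
  axiom \<open>\<Gamma>, A \<turnstile> A\<close> is read up to the position of \<open>A\<close> in the context.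
\<close>

inductive inference :: "'a model \<Rightarrow> rule \<Rightarrow> sequent list \<Rightarrow> sequent \<Rightarrow> bool" for M where
  axiom: "A \<in> set \<Gamma> \<Longrightarrow> inference M Axiom [] (\<Gamma> \<turnstile> A)"
| atom: "L \<in> literals M \<Longrightarrow> inference M AtomRule [] (\<Gamma> \<turnstile> L)"
| top_intro: "inference M TopI [] (\<Gamma> \<turnstile> Top)"
| and_intro: "inference M AndI [\<Gamma> \<turnstile> A, \<Gamma> \<turnstile> B] (\<Gamma> \<turnstile> And A B)"
| or_intro1: "inference M OrI [\<Gamma> \<turnstile> A] (\<Gamma> \<turnstile> Or A B)"
| or_intro2: "inference M OrI [\<Gamma> \<turnstile> B] (\<Gamma> \<turnstile> Or A B)"
| forall_intro:
    "inference M ForallI (map (\<lambda>j. \<Gamma> \<turnstile> subst j x A) [1..<Suc (size_dom M)]) (\<Gamma> \<turnstile> Forall x A)"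
| exists_intro:
    "j \<in> const_indices M \<Longrightarrow> inference M ExistsI [\<Gamma> \<turnstile> subst j x A] (\<Gamma> \<turnstile> Exists x A)"
| bot_elim: "inference M BotE [\<Gamma> \<turnstile> Bot] (\<Gamma> \<turnstile> A)"
| and_elim1: "inference M AndE [\<Gamma> \<turnstile> And A B] (\<Gamma> \<turnstile> A)"
| and_elim2: "inference M AndE [\<Gamma> \<turnstile> And A B] (\<Gamma> \<turnstile> B)"
| or_elim: "inference M OrE [\<Gamma> \<turnstile> Or A B, A # \<Gamma> \<turnstile> C, B # \<Gamma> \<turnstile> C] (\<Gamma> \<turnstile> C)"
| forall_elim:
    "j \<in> const_indices M \<Longrightarrow> inference M ForallE [\<Gamma> \<turnstile> Forall x A] (\<Gamma> \<turnstile> subst j x A)"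
| exists_elim:
    "inference M ExistsE
      ((\<Gamma> \<turnstile> Exists x A) # map (\<lambda>j. subst j x A # \<Gamma> \<turnstile> C) [1..<Suc (size_dom M)]) (\<Gamma> \<turnstile> C)"

datatype derivation = Derivation (concl: sequent) rule "derivation list"

primrec is_proof :: "'a model \<Rightarrow> derivation \<Rightarrow> bool" where
  "is_proof M (Derivation s r ds) \<longleftrightarrow>
    wf_sequent M s \<and> inference M r (map concl ds) s \<and> list_all (is_proof M) ds"

primrec rules_used :: "derivation \<Rightarrow> rule set" where
  "rules_used (Derivation s r ds) = insert r (\<Union> (set (map rules_used ds)))"

definition proof_of :: "'a model \<Rightarrow> derivation \<Rightarrow> sequent \<Rightarrow> bool" where
  "proof_of M d s \<longleftrightarrow> is_proof M d \<and> concl d = s"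

end

theory Submission
  imports Defs
begin

text \<open>
  Soundness holds sequent by sequent, for every assignment to the free variables that may occur in
  the sequents of a proof. Conversely, a true closed proposition is proved by introduction rules
  following its structure: a true closed literal belongs to \<open>\<P>\<close>, and since every element of the
  domain is named by a constant, the truth of a quantified proposition reduces to that of its
  instances \<open>(c\<^sub>j/x)A\<close>.
\<close>

lemma const_indices_eq_set_upt: "const_indices M = set [1..<Suc (size_dom M)]"
  by (auto simp: const_indices_def)

lemma term_val_term_subst: "term_val M e (term_subst j x t) = term_val M (e(x := elt M j)) t"
  by (cases t) auto

text \<open>The assignment is generalised because quantifiers update it. If the bound variable
  \<open>y\<close> is \<open>x\<close>, its update overrides the one at \<open>x\<close>, and
  \<open>subst\<close> leaves the body alone; otherwise the two updates commute.\<close>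

lemma holds_subst: "holds M e (subst j x A) \<longleftrightarrow> holds M (e(x := elt M j)) A"
proof (induction A arbitrary: e)
  case (Forall y A)
  show ?case
  proof (cases "y = x")
    case False
    then have "holds M (e(y := a)) (subst j x A) \<longleftrightarrow> holds M (e(x := elt M j, y := a)) A" for a
      using Forall.IH[of "e(y := a)"] by (simp only: fun_upd_twist[OF False])
    then show ?thesis using False by (simp del: fun_upd_apply)
  qed (simp del: fun_upd_apply)
next
  case (Exists y A)
  show ?case
  proof (cases "y = x")
    case False
    then have "holds M (e(y := a)) (subst j x A) \<longleftrightarrow> holds M (e(x := elt M j, y := a)) A" for a
      using Exists.IH[of "e(y := a)"] by (simp only: fun_upd_twist[OF False])
    then show ?thesis using False by (simp del: fun_upd_apply)
  qed (simp del: fun_upd_apply)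
qed (simp_all add: term_val_term_subst o_def)

text \<open>\<open>dom_of M\<close> is the image of \<open>const_indices M\<close> under
  \<open>elt M\<close>, so ranging over elements amounts to ranging over constants. In this form
  truth matches the premises of the quantifier rules.\<close>

lemma holds_Forall_iff_instances:
  "holds M e (Forall x A) \<longleftrightarrow> (\<forall>j\<in>const_indices M. holds M e (subst j x A))"
  by (simp add: dom_of_def holds_subst)

lemma holds_Exists_iff_instances:
  "holds M e (Exists x A) \<longleftrightarrow> (\<exists>j\<in>const_indices M. holds M e (subst j x A))"
  by (simp add: dom_of_def holds_subst)

lemma term_vars_term_subst: "term_vars (term_subst j x t) = term_vars t - {x}"
  by (cases t) auto

lemma free_vars_subst: "free_vars (subst j x A) = free_vars A - {x}"
  by (induction A) (auto simp: term_vars_term_subst)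

lemma wf_term_term_subst:
  "wf_term M t \<Longrightarrow> j \<in> const_indices M \<Longrightarrow> wf_term M (term_subst j x t)"
  by (cases t) auto

lemma wf_prop_subst:
  "wf_prop M A \<Longrightarrow> j \<in> const_indices M \<Longrightarrow> wf_prop M (subst j x A)"
  by (induction A) (auto simp: wf_atom_def wf_term_term_subst)

lemma holds_literals: "L \<in> literals M \<Longrightarrow> holds M e L"
  by (auto simp: literals_def o_def)

text \<open>One assignment is kept fixed: quantifiers are treated through constant instances,
  without eigenvariables, so every rule preserves truth under each \<open>e\<close>
  separately.\<close>

primrec seq_holds :: "'a model \<Rightarrow> (nat \<Rightarrow> 'a) \<Rightarrow> sequent \<Rightarrow> bool" where
  "seq_holds M e (\<Gamma> \<turnstile> A) \<longleftrightarrow> ((\<forall>B\<in>set \<Gamma>. holds M e B) \<longrightarrow> holds M e A)"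

lemma inference_sound:
  assumes "inference M r ps s" and "\<forall>p\<in>set ps. seq_holds M e p"
  shows "seq_holds M e s"
  using assms
proof cases
  case (atom L \<Gamma>)
  then show ?thesis by (simp add: holds_literals)
next
  case (forall_intro \<Gamma> x A)
  then show ?thesis using assms(2)
    by (simp only: seq_holds.simps holds_Forall_iff_instances const_indices_eq_set_upt) auto
next
  case (exists_intro j \<Gamma> x A)
  then show ?thesis using assms(2)
    by (simp only: seq_holds.simps holds_Exists_iff_instances) auto
next
  case (forall_elim j \<Gamma> x A)
  then have "seq_holds M e (\<Gamma> \<turnstile> Forall x A)" using assms(2) by simp
  then show ?thesis using forall_elim
    by (simp only: seq_holds.simps holds_Forall_iff_instances) auto
next
  case (exists_elim \<Gamma> x A C)
  then have "seq_holds M e (\<Gamma> \<turnstile> Exists x A)"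
    and "\<forall>j\<in>const_indices M. seq_holds M e (subst j x A # \<Gamma> \<turnstile> C)"
    using assms(2) by (simp, simp only: const_indices_eq_set_upt) auto
  \<comment> \<open>A true existential has a true instance \<open>subst j x A\<close>; the minor
    premise for that \<open>j\<close> yields \<open>C\<close>.\<close>
  then show ?thesis unfolding \<open>s = _\<close>
    by (simp only: seq_holds.simps holds_Exists_iff_instances) auto
qed auto

lemma is_proof_sound: "is_proof M d \<Longrightarrow> seq_holds M e (concl d)"
proof (induction d)
  case (Derivation s r ds)
  then have "\<forall>p\<in>set (map concl ds). seq_holds M e p" by (auto simp: list_all_iff)
  then show ?case using Derivation.prems inference_sound by fastforce
qed

text \<open>The empty context suffices, since every introduction rule has the same context in its
  premises as in its conclusion.\<close>

definition intro_provable :: "'a model \<Rightarrow> formula \<Rightarrow> bool" where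
  "intro_provable M A \<longleftrightarrow> (\<exists>d. proof_of M d ([] \<turnstile> A) \<and> rules_used d \<subseteq> intro_rules)"

lemma intro_provable_step:
  assumes "inference M r (map (\<lambda>A. [] \<turnstile> A) As) ([] \<turnstile> B)" and "r \<in> intro_rules"
    and "wf_prop M B" and "\<forall>A\<in>set As. intro_provable M A"
  shows "intro_provable M B"
proof -
  \<comment> \<open>\<open>f\<close> chooses one derivation for each premise; these become the
    immediate subtrees below the new root.\<close>
  obtain f where f: "\<forall>A\<in>set As. proof_of M (f A) ([] \<turnstile> A) \<and> rules_used (f A) \<subseteq> intro_rules"
    using assms(4) unfolding intro_provable_def by metis
  define d where "d = Derivation ([] \<turnstile> B) r (map f As)"
  have "map concl (map f As) = map (\<lambda>A. [] \<turnstile> A) As"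
    using f by (simp add: proof_of_def)
  then have "proof_of M d ([] \<turnstile> B)"
    using f assms(1,3) by (simp add: d_def proof_of_def list_all_iff del: map_map)
  moreover have "rules_used d \<subseteq> intro_rules"
    using f assms(2) by (auto simp: d_def)
  ultimately show ?thesis unfolding intro_provable_def by blast
qed

lemma intro_provable_literals:
  "L \<in> literals M \<Longrightarrow> wf_prop M L \<Longrightarrow> intro_provable M L"
  by (rule intro_provable_step[where As = "[]" and r = AtomRule])
     (simp_all add: inference.atom intro_rules_def)

text \<open>A term without variables is a constant, which brings a closed atom into the index-list
  form used by \<open>literals\<close>.\<close>

lemma closed_wf_atom_constants:
  assumes "wf_atom M i ts" and "(\<Union>t\<in>set ts. term_vars t) = {}"
  obtains js where "ts = map Const js" and "i \<in> pred_indices M"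
    and "length js = arity M i" and "set js \<subseteq> const_indices M"
proof -
  have "\<exists>j. t = Const j" if "t \<in> set ts" for t
  proof -
    have "term_vars t = {}" using that assms(2) by blast
    then show ?thesis by (cases t rule: fterm.exhaust) auto
  qed
  then obtain js where "ts = map Const js"
    using ex_map_conv[of ts Const] by blast
  with assms(1) show thesis by (intro that[of js]) (auto simp: wf_atom_def)
qed

text \<open>A measure for the completeness induction: an instance of a quantified body is not a
  subformula, but substitution leaves this count unchanged.\<close>

primrec num_connectives :: "formula \<Rightarrow> nat" where
  "num_connectives (Atom i ts) = 0"
| "num_connectives (NegAtom i ts) = 0"
| "num_connectives Top = 0"
| "num_connectives Bot = 0"
| "num_connectives (And A B) = Suc (num_connectives A + num_connectives B)"
| "num_connectives (Or A B) = Suc (num_connectives A + num_connectives B)"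
| "num_connectives (Forall x A) = Suc (num_connectives A)"
| "num_connectives (Exists x A) = Suc (num_connectives A)"

lemma num_connectives_subst: "num_connectives (subst j x A) = num_connectives A"
  by (induction A) auto

text \<open>Since negation occurs only on atoms, the truth of a compound proposition always comes
  from the truth of components or instances, which are the premises of its introduction rule.
  Instances use constants, so they stay closed and \<open>e\<close> never changes.\<close>

lemma intro_complete:
  assumes "wf_prop M A" and "closed_prop A" and "holds M e A"
  shows "intro_provable M A"
  using assms
proof (induction A rule: measure_induct_rule[where f = num_connectives])
  case (less A)
  show ?case
  proof (cases A)
    case (Atom i ts)
    with less.prems obtain js where "ts = map Const js" "i \<in> pred_indices M"
      "length js = arity M i" "set js \<subseteq> const_indices M"
      by (auto simp: closed_prop_def elim: closed_wf_atom_constants)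
    \<comment> \<open>As \<open>A\<close> is true, the conditional in \<open>literals\<close>
      selects \<open>A\<close> rather than its negation.\<close>
    with Atom less.prems(3) have "A \<in> literals M"
      by (fastforce simp: literals_def o_def)
    then show ?thesis using less.prems(1) by (rule intro_provable_literals)
  next
    case (NegAtom i ts)
    with less.prems obtain js where "ts = map Const js" "i \<in> pred_indices M"
      "length js = arity M i" "set js \<subseteq> const_indices M"
      by (auto simp: closed_prop_def elim: closed_wf_atom_constants)
    with NegAtom less.prems(3) have "A \<in> literals M"
      by (fastforce simp: literals_def o_def)
    then show ?thesis using less.prems(1) by (rule intro_provable_literals)
  next
    case Top
    then show ?thesis
      by (intro intro_provable_step[where As = "[]" and r = TopI])
         (simp_all add: inference.top_intro intro_rules_def)
  next
    case Bot
    then show ?thesis using less.prems by simp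
  next
    case (And C D)
    then have "intro_provable M C" "intro_provable M D"
      using less by (auto simp: closed_prop_def)
    then show ?thesis using less.prems(1) And
      by (intro intro_provable_step[where As = "[C, D]" and r = AndI])
         (simp_all add: inference.and_intro intro_rules_def)
  next
    case (Or C D)
    then have "intro_provable M C \<or> intro_provable M D"
      using less by (auto simp: closed_prop_def)
    then show ?thesis
    proof
      assume "intro_provable M C"
      then show ?thesis using less.prems(1) Or
        by (intro intro_provable_step[where As = "[C]" and r = OrI])
           (simp_all add: inference.or_intro1 intro_rules_def)
    next
      assume "intro_provable M D"
      then show ?thesis using less.prems(1) Or
        by (intro intro_provable_step[where As = "[D]" and r = OrI])
           (simp_all add: inference.or_intro2 intro_rules_def)
    qed
  next
    case (Forall x C)
    \<comment> \<open>At most \<open>x\<close> is free in \<open>C\<close>, so each instance is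
      closed, and it has one connective fewer than \<open>A\<close>. For an empty domain there are
      no instances and \<open>ForallI\<close> has no premises.\<close>
    have "intro_provable M (subst j x C)" if "j \<in> const_indices M" for j
    proof (rule less.IH)
      show "holds M e (subst j x C)"
        using less.prems(3) that unfolding Forall holds_Forall_iff_instances by blast
    qed (use less.prems that Forall in
          \<open>auto simp: num_connectives_subst wf_prop_subst closed_prop_def free_vars_subst\<close>)
    moreover have "inference M ForallI
        (map (\<lambda>A. [] \<turnstile> A) (map (\<lambda>j. subst j x C) [1..<Suc (size_dom M)])) ([] \<turnstile> A)"
      using inference.forall_intro[of M "[]" x C] by (simp add: Forall o_def del: upt_Suc)
    ultimately show ?thesis using less.prems(1)
      by (intro intro_provable_step[where r = ForallI
            and As = "map (\<lambda>j. subst j x C) [1..<Suc (size_dom M)]"])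
         (auto simp: intro_rules_def const_indices_eq_set_upt simp del: upt_Suc)
  next
    case (Exists x C)
    \<comment> \<open>The element witnessing the existential is named by a constant, whose index
      selects the premise of \<open>ExistsI\<close>.\<close>
    obtain j where j: "j \<in> const_indices M" "holds M e (subst j x C)"
      using less.prems(3) unfolding Exists holds_Exists_iff_instances by blast
    then have "intro_provable M (subst j x C)"
      using less.prems(1,2) Exists
      by (intro less.IH)
         (auto simp: num_connectives_subst wf_prop_subst closed_prop_def free_vars_subst)
    then show ?thesis using less.prems(1) Exists j(1)
      by (intro intro_provable_step[where As = "[subst j x C]" and r = ExistsI])
         (simp_all add: inference.exists_intro intro_rules_def)
  qed
qed

theorem theorem1:
  fixes M :: "'a model" and B :: formula
  assumes "finite_model M" and "wf_prop M B" and "closed_prop B"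
  shows "((\<exists>d. proof_of M d ([] \<turnstile> B)) \<longleftrightarrow> valid_in M B) \<and>
    (valid_in M B \<longleftrightarrow> (\<exists>d. proof_of M d ([] \<turnstile> B) \<and> rules_used d \<subseteq> intro_rules))"
proof -
  have "valid_in M B" if "proof_of M d ([] \<turnstile> B)" for d
    unfolding valid_in_def
  proof
    fix e
    show "holds M e B"
      using is_proof_sound[of M d e] that by (simp add: proof_of_def)
  qed
  \<comment> \<open>Truth under any single assignment is enough here; assignments take values in the
    whole type, so one exists even for an empty domain.\<close>
  moreover have "\<exists>d. proof_of M d ([] \<turnstile> B) \<and> rules_used d \<subseteq> intro_rules" if "valid_in M B"
    using intro_complete[OF assms(2,3)] that by (simp add: valid_in_def intro_provable_def)
  \<comment> \<open>The cycle closes because an introduction-only proof is in particular a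
    proof.\<close>
  ultimately show ?thesis by blast
qed

end
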